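(* Let $a,b,c,\mu\in\mathbb{C}$ with $c,\,c-\mu\notin\mathbb{Z}_{\le 0}$ and $\operatorname{Re}a>\operatorname{Re}\mu>0$, $\operatorname{Re}b>\operatorname{Re}\mu$. Then for all real $x<1$ $$\int_{-\infty}^x {}_2F_1(a,b;c;y)\,\frac{(x-y)^{\mu-1}}{\Gamma(\mu)}\,dy=\frac{\Gamma(a-\mu)}{\Gamma(a)}\,\frac{\Gamma(b-\mu)}{\Gamma(b)}\,\frac{\Gamma(c)}{\Gamma(c-\mu)}\;{}_2F_1(a-\mu,b-\mu;c-\mu;x).$$
   Context: ${}_2F_1(a,b;c;z)$ denotes the Gauss hypergeometric function, defined for $|z|<1$ by $\sum_{k\ge0}\frac{(a)_k(b)_k}{(c)_k\,k!}z^k$ (with $c\notin\mathbb{Z}_{\le0}$) and extended by its one-valued analytic continuation to $\mathbb{C}\setminus[1,\infty)$. *)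

theory Defs
  imports "HOL-Complex_Analysis.Complex_Analysis"
begin

definition slit_plane :: "complex set" where
  "slit_plane = - (complex_of_real ` {1..})"

definition hypergeo_2F1_coeff :: "complex \<Rightarrow> complex \<Rightarrow> complex \<Rightarrow> nat \<Rightarrow> complex" where
  "hypergeo_2F1_coeff a b c k =
     pochhammer a k * pochhammer b k / (pochhammer c k * fact k)"

text \<open>
  The Gauss series on the unit disc together with its analytic continuation to the plane cut
  along \<open>[1, \<infinity>)\<close>. The cut plane is connected, so the values of such a function there are
  unique by the identity theorem. The values on the cut itself are unspecified, and the function
  is only meaningful for \<open>c\<close> not a non-positive integer.
\<close>

definition hypergeo_2F1 :: "complex \<Rightarrow> complex \<Rightarrow> complex \<Rightarrow> complex \<Rightarrow> complex" where
  "hypergeo_2F1 a b c = (SOME f. f holomorphic_on slit_plane \<and>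
     (\<forall>z\<in>ball 0 1. (\<lambda>k. hypergeo_2F1_coeff a b c k * z ^ k) sums f z))"

end

theory Submission
  imports Defs
begin

text \<open>
  For \<open>Re c > Re b > 0\<close> the function is given on the cut plane by Euler's integral of \<open>(1-zt)^(-a)\<close>
  against a Beta weight. By Fubini the fractional integral may be taken under that integral, where
  it is a scaled Beta integral producing \<open>t^(-\<mu>) (1-xt)^(\<mu>-a)\<close>: this is again an Euler integral, with
  parameters lowered by \<open>\<mu>\<close>. The restriction on \<open>c\<close> is removed by the contiguous relation
  \<open>F(a,b;c;z) = F(a,b;c+1;z) + ab/(c(c+1)) z F(a+1,b+1;c+2;z)\<close>. It yields the analytic continuation
  for every admissible \<open>c\<close>, and it reduces the identity for \<open>(a,b,c,\<mu>)\<close> to those for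
  \<open>(a,b,c+1,\<mu>)\<close>, \<open>(a+1,b+1,c+2,\<mu>)\<close> and \<open>(a+1,b+1,c+2,\<mu>+1)\<close>, in each of which \<open>Re (c - b)\<close> has
  grown by one.
\<close>

section \<open>Gamma and Beta integrals with complex parameters\<close>

text \<open>Restricting the measure, instead of multiplying integrands by an indicator, makes
  positivity available as membership in the space, also in both factors of the product used for
  Fubini.\<close>

abbreviation half_line :: "real measure" where
  "half_line \<equiv> restrict_space lborel {0<..}"

lemma borel_measurable_half_line_id [measurable]: "(\<lambda>t. t) \<in> borel_measurable half_line"
  by (intro measurable_restrict_space1) simp

lemma borel_measurable_half_line_fst [measurable]:
    "(\<lambda>x. fst x) \<in> borel_measurable (half_line \<Otimes>\<^sub>M M)"
  and borel_measurable_half_line_snd [measurable]: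
    "(\<lambda>x. snd x) \<in> borel_measurable (M \<Otimes>\<^sub>M half_line)"
  by (rule measurable_compose[OF measurable_fst borel_measurable_half_line_id]
      measurable_compose[OF measurable_snd borel_measurable_half_line_id])+

lemma space_half_line [simp]: "space half_line = {0<..}"
  by (simp add: space_restrict_space)

interpretation half_line: sigma_finite_measure half_line
  by (rule sigma_finite_measure_restrict_space) (auto simp: lborel.sigma_finite_measure_axioms)

interpretation half_line_pair: pair_sigma_finite half_line half_line ..

lemma has_bochner_integral_half_line_iff:
  fixes f :: "real \<Rightarrow> complex"
  shows "has_bochner_integral half_line f I \<longleftrightarrow>
    has_bochner_integral lborel (\<lambda>t. indicator {0<..} t *\<^sub>R f t) I"
  by (simp add: has_bochner_integral_iff integrable_restrict_space integral_restrict_space)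

text \<open>
  For \<open>t > 0\<close> this is \<open>of_real t powr z\<close>; unlike the latter it is multiplicative in the exponent and
  measurable in \<open>t\<close> without side conditions. For \<open>t \<le> 0\<close> its value is meaningless.
\<close>

definition rpow :: "real \<Rightarrow> complex \<Rightarrow> complex" where
  "rpow t z = exp (z * of_real (ln t))"

lemma rpow_eq_powr: "t > 0 \<Longrightarrow> rpow t z = of_real t powr z"
  by (simp add: rpow_def powr_def Ln_of_real)

lemma rpow_add: "rpow t (z + w) = rpow t z * rpow t w"
  by (simp add: rpow_def distrib_right exp_add)

lemma rpow_mult: "s > 0 \<Longrightarrow> t > 0 \<Longrightarrow> rpow (s * t) z = rpow s z * rpow t z"
  by (simp add: rpow_def ln_mult distrib_left exp_add)

lemma rpow_divide: "s > 0 \<Longrightarrow> t > 0 \<Longrightarrow> rpow (s / t) z = rpow s z * rpow t (- z)"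
  by (simp add: rpow_def ln_div right_diff_distrib exp_diff exp_minus) (simp add: divide_inverse)

lemma rpow_one: "t > 0 \<Longrightarrow> rpow t 1 = of_real t"
  by (simp add: rpow_eq_powr)

text \<open>An exponential has modulus \<open>exp\<close> of the real part of its exponent. Hence
  the norm of an integrand built from \<open>rpow\<close> and positive factors is the same integrand
  at the real parts of its parameters, and absolute integrability reduces to an integral already
  computed.\<close>

lemma of_real_norm_rpow: "of_real (norm (rpow t z)) = rpow t (of_real (Re z))"
  by (simp add: rpow_def exp_of_real flip: of_real_mult)

lemma borel_measurable_rpow [measurable]:
  assumes [measurable]: "f \<in> borel_measurable M"
  shows "(\<lambda>x. rpow (f x) z) \<in> borel_measurable M"
  unfolding rpow_def by measurable

lemma has_bochner_integral_half_line_scale: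
  fixes f :: "real \<Rightarrow> complex"
  assumes "has_bochner_integral half_line f I" "k > 0"
  shows "has_bochner_integral half_line (\<lambda>t. f (k * t)) (I / of_real k)"
proof -
  have "has_bochner_integral lborel (\<lambda>t. indicator {0<..} (0 + k * t) *\<^sub>R f (0 + k * t)) (I /\<^sub>R \<bar>k\<bar>)"
    using assms by (subst lborel_has_bochner_integral_real_affine_iff[symmetric])
      (simp_all add: has_bochner_integral_half_line_iff)
  moreover have "indicator {0<..} (0 + k * t) *\<^sub>R f (0 + k * t) = indicator {0<..} t *\<^sub>R f (k * t)" for t
    using assms(2) by (simp add: indicator_def zero_less_mult_iff)
  moreover have "I /\<^sub>R \<bar>k\<bar> = I / of_real k"
    using assms(2) by (simp add: scaleR_conv_of_real divide_inverse mult.commute)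
  ultimately show ?thesis
    by (simp only: has_bochner_integral_half_line_iff)
qed

text \<open>Evaluation by exchanging the order: \<open>g\<close> and \<open>h\<close> are the two
  inner integrals, and \<open>I\<close> is computed from \<open>g\<close>. The premises
  \<open>inner\<close> and \<open>nrm\<close> give absolute integrability on the product.\<close>

lemma (in pair_sigma_finite) has_bochner_integral_Fubini:
  fixes f :: "'a \<Rightarrow> 'b \<Rightarrow> complex"
  assumes meas: "case_prod f \<in> borel_measurable (M1 \<Otimes>\<^sub>M M2)"
    and inner: "\<And>x. x \<in> space M1 \<Longrightarrow> has_bochner_integral M2 (f x) (g x)"
    and nrm: "integrable M1 (\<lambda>x. \<integral>y. norm (f x y) \<partial>M2)"
    and h: "\<And>y. y \<in> space M2 \<Longrightarrow> (\<integral>x. f x y \<partial>M1) = h y"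
    and outer: "has_bochner_integral M1 g I"
  shows "has_bochner_integral M2 h I"
proof -
  have int: "integrable (M1 \<Otimes>\<^sub>M M2) (case_prod f)"
  proof (rule Fubini_integrable)
    show "integrable M1 (\<lambda>x. \<integral>y. norm (case_prod f (x, y)) \<partial>M2)"
      using nrm by simp
    show "AE x in M1. integrable M2 (\<lambda>y. case_prod f (x, y))"
      using inner by (intro AE_I2) (auto simp: has_bochner_integral_iff)
  qed fact
  have "(\<integral>y. (\<integral>x. f x y \<partial>M1) \<partial>M2) = (\<integral>x. (\<integral>y. f x y \<partial>M2) \<partial>M1)"
    by (rule Fubini_integral[OF int])
  also have "\<dots> = (\<integral>x. g x \<partial>M1)"
    using inner by (intro Bochner_Integration.integral_cong) (auto simp: has_bochner_integral_iff)
  also have "\<dots> = I"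
    using outer by (simp add: has_bochner_integral_iff)
  finally have "has_bochner_integral M2 (\<lambda>y. \<integral>x. f x y \<partial>M1) I"
    using integrable_snd[OF int] by (simp add: has_bochner_integral_iff)
  then show ?thesis
    using h by (subst has_bochner_integral_cong[OF refl _ refl, symmetric]) auto
qed

lemma has_bochner_integral_norm_eq_Re:
  fixes f g :: "'a \<Rightarrow> complex"
  assumes "has_bochner_integral M g I" "\<And>x. x \<in> space M \<Longrightarrow> of_real (norm (f x)) = g x"
  shows "has_bochner_integral M (\<lambda>x. norm (f x)) (Re I)"
proof -
  have "has_bochner_integral M (\<lambda>x. Re (g x)) (Re I)"
    using assms(1) by (rule has_bochner_integral_Re)
  then show ?thesis
    using assms(2) by (subst has_bochner_integral_cong[OF refl _ refl]) (auto, metis Re_complex_of_real)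
qed

lemma has_bochner_integral_Gamma:
  assumes z: "Re z > 0" and k: "k > 0"
  shows "has_bochner_integral half_line (\<lambda>t. rpow t (z - 1) * of_real (exp (- (k * t))))
    (Gamma z * rpow k (- z))"
proof -
  let ?g = "\<lambda>t. complex_of_real t powr (z - 1) / of_real (exp t)"
  let ?h = "\<lambda>t. indicator {0<..} t *\<^sub>R (rpow t (z - 1) * of_real (exp (- t)))"
  have eq: "indicator {0<..} t *\<^sub>R ?g t = ?h t" for t
    by (auto simp: indicator_def rpow_eq_powr exp_minus divide_inverse)
  have m: "?h \<in> borel_measurable borel"
    by measurable
  have "integrable lebesgue ?h"
    using absolutely_integrable_Gamma_integral'[OF z] unfolding set_integrable_def eq .
  with m have int: "integrable lborel ?h"
    by (simp add: integrable_completion)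
  then have "(?h has_integral (\<integral>t. ?h t \<partial>lborel)) UNIV"
    by (rule has_integral_integral_lborel)
  moreover have "(?h has_integral Gamma z) UNIV"
  proof -
    have "((\<lambda>t. if t \<in> {0<..} then ?g t else 0) has_integral Gamma z) UNIV"
      using Gamma_integral_complex'[OF z] by (subst has_integral_restrict_UNIV) auto
    also have "(\<lambda>t. if t \<in> {0<..} then ?g t else 0) = ?h"
      by (auto simp: fun_eq_iff indicator_def rpow_eq_powr exp_minus divide_inverse)
    finally show ?thesis .
  qed
  ultimately have "(\<integral>t. ?h t \<partial>lborel) = Gamma z"
    by (rule has_integral_unique)
  with int have "has_bochner_integral half_line (\<lambda>t. rpow t (z - 1) * of_real (exp (- t))) (Gamma z)"
    unfolding has_bochner_integral_half_line_iff by (simp add: has_bochner_integral_iff)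
  \<comment> \<open>Replacing t by k t produces the factor \<open>rpow k (z - 1)\<close> in the
    integrand and 1 / k in the value; multiplication by \<open>rpow k (1 - z)\<close> cancels the
    first and leaves \<open>rpow k (- z)\<close> in the value.\<close>
  from has_bochner_integral_half_line_scale[OF this k]
  have "has_bochner_integral half_line (\<lambda>t. rpow k (1 - z) * (rpow (k * t) (z - 1) * of_real (exp (- (k * t)))))
     (rpow k (1 - z) * (Gamma z / of_real k))"
    by (intro has_bochner_integral_mult_right) simp_all
  moreover have "rpow k (1 - z) * (rpow (k * t) (z - 1) * of_real (exp (- (k * t)))) =
      rpow t (z - 1) * of_real (exp (- (k * t)))" if "t \<in> space half_line" for t
    using that k rpow_add[of k "1 - z" "z - 1"] by (simp add: rpow_mult) (simp add: rpow_def)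
  moreover have "rpow k (1 - z) * (Gamma z / of_real k) = Gamma z * rpow k (- z)"
    using k rpow_add[of k 1 "- z"] by (simp add: rpow_one)
  ultimately show ?thesis
    by (subst has_bochner_integral_cong[OF refl _ refl, symmetric]) auto
qed

lemma not_nonpos_Int_if_Re_pos: "Re z > 0 \<Longrightarrow> z \<notin> \<int>\<^sub>\<le>\<^sub>0"
  by (auto elim!: nonpos_Ints_cases)

text \<open>The double integral of u^(p-1) s^(p+q-1) exp(-s(1+u)) is evaluated in both orders.
  Integration over u first leaves Gamma(p) s^(q-1) exp(-s), and then Gamma(p) Gamma(q); integration
  over s first leaves Gamma(p+q) times the Beta integrand.\<close>

lemma has_bochner_integral_Beta:
  assumes p: "Re p > 0" and q: "Re q > 0"
  shows "has_bochner_integral half_line (\<lambda>u. rpow u (p - 1) * rpow (1 + u) (- (p + q)))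
    (Gamma p * Gamma q / Gamma (p + q))"
proof -
  define f where "f p q s u = rpow u (p - 1) * rpow s (p + q - 1) * of_real (exp (- (s * (1 + u))))"
    for p q :: complex and s u :: real
  \<comment> \<open>Stated for all p and q, as their real parts are needed too for the integral of
    the norm. The form \<open>1 * s\<close> keeps the value an instance of the Gamma integrand with
    \<open>k = 1\<close>.\<close>
  have inner: "has_bochner_integral half_line (f p q s) (Gamma p * (rpow s (q - 1) * of_real (exp (- (1 * s)))))"
    if "Re p > 0" "s > 0" for p q s
  proof -
    have "has_bochner_integral half_line
        (\<lambda>u. rpow s (p + q - 1) * of_real (exp (- s)) * (rpow u (p - 1) * of_real (exp (- (s * u)))))
        (rpow s (p + q - 1) * of_real (exp (- s)) * (Gamma p * rpow s (- p)))"
      using that by (intro has_bochner_integral_mult_right has_bochner_integral_Gamma)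
    moreover have "rpow s (p + q - 1) * of_real (exp (- s)) * (rpow u (p - 1) * of_real (exp (- (s * u)))) = f p q s u" for u
      by (simp add: f_def distrib_left exp_diff exp_minus divide_inverse mult_ac)
    moreover have "rpow s (p + q - 1) * of_real (exp (- s)) * (Gamma p * rpow s (- p)) =
        Gamma p * (rpow s (q - 1) * of_real (exp (- (1 * s))))"
      using rpow_add[of s "p + q - 1" "- p"] by (simp add: algebra_simps)
    ultimately show ?thesis by simp
  qed
  have norm_f: "of_real (norm (f p q s u)) = f (of_real (Re p)) (of_real (Re q)) s u" for s u
    by (simp add: f_def norm_mult of_real_norm_rpow del: of_real_mult of_real_add of_real_exp)
      (simp add: of_real_norm_rpow)
  have *: "has_bochner_integral half_line (\<lambda>u. Gamma (p + q) * (rpow u (p - 1) * rpow (1 + u) (- (p + q))))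
     (Gamma p * (Gamma q * rpow 1 (- q)))"
  proof (rule half_line_pair.has_bochner_integral_Fubini)
    show "case_prod (f p q) \<in> borel_measurable (half_line \<Otimes>\<^sub>M half_line)"
      unfolding f_def by measurable
    show "has_bochner_integral half_line (f p q s) (Gamma p * (rpow s (q - 1) * of_real (exp (- (1 * s)))))"
      if "s \<in> space half_line" for s using inner[of p s q] that p by simp
    show "has_bochner_integral half_line (\<lambda>s. Gamma p * (rpow s (q - 1) * of_real (exp (- (1 * s)))))
        (Gamma p * (Gamma q * rpow 1 (- q)))"
      using q by (intro has_bochner_integral_mult_right has_bochner_integral_Gamma) auto
    have nrm: "has_bochner_integral half_line (\<lambda>u. norm (f p q s u))
        (Re (Gamma (of_real (Re p)) * (rpow s (of_real (Re q) - 1) * of_real (exp (- (1 * s))))))"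
      if "s > 0" for s
      using inner[of "of_real (Re p)" s "of_real (Re q)"] p that norm_f
      by (intro has_bochner_integral_norm_eq_Re) auto
    have "integrable half_line (\<lambda>s. Re (Gamma (of_real (Re p)) * (rpow s (of_real (Re q) - 1) * of_real (exp (- (1 * s))))))"
      using q has_bochner_integral_Gamma[of "of_real (Re q)" 1]
      by (intro integrable_Re integrable_mult_right) (auto simp: has_bochner_integral_iff)
    then show "integrable half_line (\<lambda>s. \<integral>u. norm (f p q s u) \<partial>half_line)"
      using nrm by (subst Bochner_Integration.integrable_cong[OF refl]) (auto simp: has_bochner_integral_iff)
    show "(\<integral>s. f p q s u \<partial>half_line) = Gamma (p + q) * (rpow u (p - 1) * rpow (1 + u) (- (p + q)))"
      if "u \<in> space half_line" for u
    proof -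
      have "has_bochner_integral half_line (\<lambda>s. rpow u (p - 1) * (rpow s (p + q - 1) * of_real (exp (- ((1 + u) * s)))))
         (rpow u (p - 1) * (Gamma (p + q) * rpow (1 + u) (- (p + q))))"
        using that p q by (intro has_bochner_integral_mult_right has_bochner_integral_Gamma) auto
      then show ?thesis
        by (simp add: has_bochner_integral_iff f_def mult_ac)
    qed
  qed
  have "Gamma (p + q) \<noteq> 0"
    using p q by (simp add: Gamma_eq_zero_iff not_nonpos_Int_if_Re_pos)
  with has_bochner_integral_mult_right[OF *, of "inverse (Gamma (p + q))"] show ?thesis
    by (simp add: field_simps) (simp add: rpow_def)
qed

text \<open>Since A + B w = A (1 + k w) with k = B / A, this is the Beta integral after the
  substitution u = k w. In the fractional integral it occurs with A = 1 - x t and B = t.\<close>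

lemma has_bochner_integral_Beta_affine:
  assumes p: "Re p > 0" and q: "Re q > 0" and A: "A > 0" and B: "B > 0"
  shows "has_bochner_integral half_line (\<lambda>w. rpow w (p - 1) * rpow (A + B * w) (- (p + q)))
    (rpow A (- q) * rpow B (- p) * (Gamma p * Gamma q / Gamma (p + q)))"
proof -
  define k where "k = B / A"
  have k: "k > 0" using A B by (simp add: k_def)
  have "has_bochner_integral half_line (\<lambda>w. rpow A (- (p + q)) * rpow k (1 - p) *
      (rpow (k * w) (p - 1) * rpow (1 + k * w) (- (p + q))))
     (rpow A (- (p + q)) * rpow k (1 - p) * (Gamma p * Gamma q / Gamma (p + q) / of_real k))"
    by (intro has_bochner_integral_mult_right has_bochner_integral_half_line_scale
        has_bochner_integral_Beta p q k)
  moreover have "rpow A (- (p + q)) * rpow k (1 - p) *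
      (rpow (k * w) (p - 1) * rpow (1 + k * w) (- (p + q))) = rpow w (p - 1) * rpow (A + B * w) (- (p + q))"
    if "w \<in> space half_line" for w
  proof -
    have "rpow (A + B * w) (- (p + q)) = rpow A (- (p + q)) * rpow (1 + k * w) (- (p + q))"
      using that A B by (subst rpow_mult[symmetric])
        (auto simp: k_def distrib_left intro!: add_pos_nonneg)
    moreover have "rpow k (1 - p) * rpow k (p - 1) = 1"
      using rpow_add[of k "1 - p" "p - 1"] by (simp add: rpow_def)
    ultimately show ?thesis
      using that k by (simp add: rpow_mult)
  qed
  moreover have "rpow A (- (p + q)) * rpow k (1 - p) * (Gamma p * Gamma q / Gamma (p + q) / of_real k)
      = rpow A (- q) * rpow B (- p) * (Gamma p * Gamma q / Gamma (p + q))"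
  proof -
    have "rpow k (1 - p) = of_real k * rpow k (- p)"
      using k rpow_add[of k 1 "- p"] by (simp add: rpow_one)
    moreover have "rpow k (- p) = rpow B (- p) * rpow A p"
      using A B by (simp add: k_def rpow_divide)
    moreover have "rpow A (- (p + q)) * rpow A p = rpow A (- q)"
      using rpow_add[of A "- (p + q)" p] by simp
    ultimately show ?thesis
      using k by simp
  qed
  ultimately show ?thesis
    by (subst has_bochner_integral_cong[OF refl _ refl, symmetric]) auto
qed

section \<open>The analytic continuation of the Gauss series\<close>

text \<open>Dominated convergence for the difference quotients at \<open>z0\<close>, along sequences
  tending to \<open>z0\<close>. The local bound \<open>w\<close> on the derivative dominates them by
  the mean value inequality, as balls are convex.\<close>

lemma holomorphic_on_integral:
  fixes f f' :: "complex \<Rightarrow> 'a \<Rightarrow> complex"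
  assumes S: "open S"
    and int: "\<And>z. z \<in> S \<Longrightarrow> integrable M (f z)"
    and deriv: "\<And>z u. z \<in> S \<Longrightarrow> u \<in> space M \<Longrightarrow> ((\<lambda>z. f z u) has_field_derivative f' z u) (at z)"
    and meas: "\<And>z. z \<in> S \<Longrightarrow> f' z \<in> borel_measurable M"
    and bound: "\<And>z0. z0 \<in> S \<Longrightarrow> \<exists>r>0. \<exists>w. ball z0 r \<subseteq> S \<and> integrable M w \<and>
      (\<forall>z\<in>ball z0 r. \<forall>u\<in>space M. norm (f' z u) \<le> w u)"
  shows "(\<lambda>z. \<integral>u. f z u \<partial>M) holomorphic_on S"
proof (unfold holomorphic_on_open[OF S], intro ballI)
  fix z0 assume z0: "z0 \<in> S"
  obtain r w where r: "r > 0" "ball z0 r \<subseteq> S" and w: "integrable M w"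
    and le: "\<And>z u. z \<in> ball z0 r \<Longrightarrow> u \<in> space M \<Longrightarrow> norm (f' z u) \<le> w u"
    using bound[OF z0] by blast
  let ?q = "\<lambda>z u. (f z u - f z0 u) / (z - z0)"
  have "((\<lambda>z. \<integral>u. f z u \<partial>M) has_field_derivative (\<integral>u. f' z0 u \<partial>M)) (at z0 within ball z0 r)"
    unfolding has_field_derivative_iff tendsto_at_iff_sequentially comp_def
  proof (intro allI impI)
    fix X :: "nat \<Rightarrow> complex"
    assume X: "\<forall>i. X i \<in> ball z0 r - {z0}" and lim: "X \<longlonglongrightarrow> z0"
    have Xr: "X i \<in> ball z0 r" and Xz: "X i \<noteq> z0" for i
      using X by blast+
    then have XS: "X i \<in> S" for i using r by blast
    have "(\<lambda>i. \<integral>u. ?q (X i) u \<partial>M) \<longlonglongrightarrow> (\<integral>u. f' z0 u \<partial>M)"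
    proof (rule integral_dominated_convergence[where w = w])
      show "f' z0 \<in> borel_measurable M" by (rule meas[OF z0])
      show "?q (X i) \<in> borel_measurable M" for i
        using int[OF XS[of i]] int[OF z0]
        by (intro borel_measurable_divide borel_measurable_diff borel_measurable_const) simp_all
      show "AE u in M. (\<lambda>i. ?q (X i) u) \<longlonglongrightarrow> f' z0 u"
      proof (rule AE_I2)
        fix u assume "u \<in> space M"
        with deriv[OF z0] have "((\<lambda>z. ?q z u) \<longlongrightarrow> f' z0 u) (at z0)"
          by (simp add: has_field_derivative_iff)
        then show "(\<lambda>i. ?q (X i) u) \<longlonglongrightarrow> f' z0 u"
          using Xz lim unfolding tendsto_at_iff_sequentially comp_def
          by (metis (no_types, lifting) DiffI UNIV_I singletonD)
      qed
      show "AE u in M. norm (?q (X i) u) \<le> w u" for i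
      proof (rule AE_I2)
        fix u assume u: "u \<in> space M"
        have "norm (f (X i) u - f z0 u) \<le> w u * norm (X i - z0)"
        proof (rule field_differentiable_bound[where S = "ball z0 r" and f' = "\<lambda>z. f' z u"])
          show "((\<lambda>z. f z u) has_field_derivative f' z u) (at z within ball z0 r)"
            if "z \<in> ball z0 r" for z
            using that r u by (blast intro: deriv has_field_derivative_at_within[of _ _ _ "ball z0 r"])
        qed (use Xr Xz r(1) u le in auto)
        then show "norm (?q (X i) u) \<le> w u"
          using Xz[of i] by (simp add: norm_divide divide_le_eq)
      qed
    qed fact
    moreover have "(\<integral>u. ?q (X i) u \<partial>M) = ((\<integral>u. f (X i) u \<partial>M) - (\<integral>u. f z0 u \<partial>M)) / (X i - z0)" for i
      by (simp add: Bochner_Integration.integral_diff[OF int[OF XS] int[OF z0]])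
    ultimately show "(\<lambda>i. ((\<integral>u. f (X i) u \<partial>M) - (\<integral>u. f z0 u \<partial>M)) / (X i - z0)) \<longlonglongrightarrow> (\<integral>u. f' z0 u \<partial>M)"
      by (simp only:)
  qed
  moreover have "at z0 within ball z0 r = at z0"
    using r(1) by (intro at_within_open) auto
  ultimately show "\<exists>D. ((\<lambda>z. \<integral>u. f z u \<partial>M) has_field_derivative D) (at z0)"
    by auto
qed

section \<open>Topology of the cut plane\<close>

lemma open_slit_plane: "open slit_plane"
proof -
  have "closed (complex_of_real ` {1..})"
    by (rule closed_injective_linear_image)
      (simp_all add: bounded_linear_of_real bounded_linear.linear inj_of_real)
  then show ?thesis unfolding slit_plane_def by (rule open_Compl)
qed

text \<open>If 1 - z t = s \<le> 0, then z = (1 - s) / t lies on the cut. So the base of the Euler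
  kernel avoids the branch cut of the principal power for every t in [0,1].\<close>

lemma one_minus_mult_in_slit:
  assumes z: "z \<in> slit_plane" and t: "0 \<le> t" "t \<le> 1"
  shows "1 - z * of_real t \<notin> \<real>\<^sub>\<le>\<^sub>0"
proof
  assume "1 - z * of_real t \<in> \<real>\<^sub>\<le>\<^sub>0"
  then obtain s where s: "1 - z * of_real t = of_real s" "s \<le> 0"
    by (auto elim!: nonpos_Reals_cases)
  then have "t \<noteq> 0" by auto
  with s(1) have "z = of_real ((1 - s) / t)"
    by (simp add: field_simps)
  moreover have "(1 - s) / t \<ge> 1"
    using s(2) t \<open>t \<noteq> 0\<close> by (simp add: field_simps)
  ultimately show False using z unfolding slit_plane_def by blast
qed

lemma slit_plane_starlike:
  assumes z: "z \<in> slit_plane" and t: "0 \<le> t" "t \<le> 1"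
  shows "of_real t * z \<in> slit_plane"
proof (rule ccontr)
  assume "of_real t * z \<notin> slit_plane"
  then obtain s where "of_real t * z = of_real s" "s \<ge> 1"
    by (auto simp: slit_plane_def)
  then have "1 - z * of_real t \<in> \<real>\<^sub>\<le>\<^sub>0"
    by (metis diff_le_0_iff_le mult.commute nonpos_Reals_of_real_iff of_real_1 of_real_diff)
  with one_minus_mult_in_slit[OF assms] show False by contradiction
qed

lemma connected_slit_plane: "connected slit_plane"
proof (rule starlike_imp_connected)
  have "closed_segment 0 z \<subseteq> slit_plane" if "z \<in> slit_plane" for z
    using slit_plane_starlike[OF that] by (auto simp: in_segment scaleR_conv_of_real)
  moreover have "0 \<in> slit_plane" by (auto simp: slit_plane_def)
  ultimately show "starlike slit_plane" unfolding starlike_def by blast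
qed

lemma ball_subset_slit_plane: "ball 0 1 \<subseteq> slit_plane"
  by (auto simp: slit_plane_def)

lemma of_real_in_slit_plane: "x < 1 \<Longrightarrow> of_real x \<in> slit_plane"
  by (auto simp: slit_plane_def)

section \<open>Uniqueness of the continuation on the cut plane\<close>

definition is_hypergeo_2F1 :: "complex \<Rightarrow> complex \<Rightarrow> complex \<Rightarrow> (complex \<Rightarrow> complex) \<Rightarrow> bool" where
  "is_hypergeo_2F1 a b c f \<longleftrightarrow> f holomorphic_on slit_plane \<and>
     (\<forall>z\<in>ball 0 1. (\<lambda>k. hypergeo_2F1_coeff a b c k * z ^ k) sums f z)"

text \<open>The two functions share their power series on the unit disc, and the identity theorem
  carries the equality over the connected cut plane.\<close>

lemma is_hypergeo_2F1_unique:
  assumes "is_hypergeo_2F1 a b c f" "is_hypergeo_2F1 a b c g" "z \<in> slit_plane"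
  shows "f z = g z"
proof (rule analytic_continuation_open[where s = "ball 0 1" and s' = slit_plane and f = f and g = g])
  show "f z = g z" if "z \<in> ball 0 1" for z
    using assms that unfolding is_hypergeo_2F1_def by (meson sums_unique2)
qed (use assms open_slit_plane connected_slit_plane ball_subset_slit_plane in
      \<open>auto simp: is_hypergeo_2F1_def\<close>)

lemma is_hypergeo_2F1_hypergeo_2F1:
  "is_hypergeo_2F1 a b c f \<Longrightarrow> is_hypergeo_2F1 a b c (hypergeo_2F1 a b c)"
  unfolding hypergeo_2F1_def is_hypergeo_2F1_def[symmetric] by (rule someI[where P = "is_hypergeo_2F1 a b c"])

text \<open>Any function with the two properties settles existence for the choice in
  \<open>hypergeo_2F1\<close> and, by uniqueness, gives its values off the cut.\<close>

lemma hypergeo_2F1_eqI: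
  "is_hypergeo_2F1 a b c f \<Longrightarrow> z \<in> slit_plane \<Longrightarrow> hypergeo_2F1 a b c z = f z"
  by (rule is_hypergeo_2F1_unique[OF is_hypergeo_2F1_hypergeo_2F1])

section \<open>Euler's integral as the continuation for Re c > Re b > 0\<close>

text \<open>
  Euler's integral \<open>\<integral> t^(b-1) (1-t)^(c-b-1) (1-zt)^(-a) dt\<close> over \<open>(0,1)\<close>, moved to the half-line by
  \<open>t = u / (1 + u)\<close>. In this form the Taylor coefficients, the Beta function and the integral over
  \<open>y\<close> in the theorem are all instances of one scaled Beta integral.
\<close>

definition euler_weight :: "complex \<Rightarrow> complex \<Rightarrow> real \<Rightarrow> complex" where
  "euler_weight b c u = rpow u (b - 1) * rpow (1 + u) (- c)"

definition euler_integral :: "complex \<Rightarrow> complex \<Rightarrow> complex \<Rightarrow> complex \<Rightarrow> complex" where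
  "euler_integral a b c z =
     (\<integral>u. euler_weight b c u * (1 - z * of_real (u / (1 + u))) powr (- a) \<partial>half_line)"

text \<open>The k-th power of t = u / (1 + u) raises both \<open>b\<close> and \<open>c\<close> by k
  and leaves c - b fixed, so each moment of the weight is again a Beta integral.\<close>

lemma has_bochner_integral_euler_weight:
  assumes "Re b > 0" "Re c > Re b"
  shows "has_bochner_integral half_line (\<lambda>u. euler_weight b c u * of_real (u / (1 + u)) ^ k)
    (Gamma (b + of_nat k) * Gamma (c - b) / Gamma (c + of_nat k))"
proof -
  have "has_bochner_integral half_line
      (\<lambda>u. rpow u (b + of_nat k - 1) * rpow (1 + u) (- (b + of_nat k + (c - b))))
      (Gamma (b + of_nat k) * Gamma (c - b) / Gamma (b + of_nat k + (c - b)))"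
    using assms by (intro has_bochner_integral_Beta) auto
  moreover have "rpow u (b + of_nat k - 1) * rpow (1 + u) (- (b + of_nat k + (c - b))) =
      euler_weight b c u * of_real (u / (1 + u)) ^ k" if "u \<in> space half_line" for u
  proof -
    have u: "u > 0" using that by simp
    have "of_real (u / (1 + u)) ^ k = rpow (u / (1 + u)) (of_nat k)"
      using u by (subst rpow_eq_powr) (auto simp: powr_nat simp del: of_real_divide)
    also have "\<dots> = rpow u (of_nat k) * rpow (1 + u) (- of_nat k)"
      using u by (simp add: rpow_divide)
    finally show ?thesis
      using rpow_add[of u "b - 1" "of_nat k"] rpow_add[of "1 + u" "- c" "- of_nat k"]
      by (simp add: euler_weight_def algebra_simps)
  qed
  ultimately show ?thesis
    by (subst has_bochner_integral_cong[OF refl _ refl, symmetric]) (auto simp: algebra_simps)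
qed

lemma integrable_euler_weight:
  "Re b > 0 \<Longrightarrow> Re c > Re b \<Longrightarrow> integrable half_line (euler_weight b c)"
  using has_bochner_integral_euler_weight[of b c 0] by (simp add: has_bochner_integral_iff)

lemma ratio_bounds:
  fixes u :: real
  assumes "u > 0"
  shows "0 < u / (1 + u)" "u / (1 + u) < 1"
  using assms by auto

lemma integrable_euler_kernel:
  fixes g :: "real \<Rightarrow> complex"
  assumes bc: "Re b > 0" "Re c > Re b" and g: "continuous_on {0..1} g"
  shows "integrable half_line (\<lambda>u. euler_weight b c u * g (u / (1 + u)))"
proof -
  obtain B where B: "\<And>t. t \<in> {0..1} \<Longrightarrow> norm (g t) \<le> B"
    using compact_imp_bounded[OF compact_continuous_image[OF g compact_Icc]]
    unfolding bounded_iff by (meson imageI)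
  have "continuous_on {0<..} (\<lambda>u::real. g (u / (1 + u)))"
    by (rule continuous_on_compose2[OF g]) (auto intro!: continuous_intros)
  then have meas: "(\<lambda>u. g (u / (1 + u))) \<in> borel_measurable half_line"
    by (subst measurable_cong_sets[OF sets_restrict_space_cong[OF sets_lborel] refl])
      (rule borel_measurable_continuous_on_restrict)
  show ?thesis
  proof (rule Bochner_Integration.integrable_bound)
    show "(\<lambda>u. euler_weight b c u * g (u / (1 + u))) \<in> borel_measurable half_line"
      using integrable_euler_weight[OF bc] meas by (intro borel_measurable_times) simp_all
    show "integrable half_line (\<lambda>u. B * norm (euler_weight b c u))"
      using integrable_euler_weight[OF bc] by simp
    show "AE u in half_line. norm (euler_weight b c u * g (u / (1 + u))) \<le> norm (B * norm (euler_weight b c u))"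
    proof (rule AE_I2)
      fix u assume "u \<in> space half_line"
      then have "norm (g (u / (1 + u))) \<le> B"
        using ratio_bounds[of u] by (intro B) auto
      then show "norm (euler_weight b c u * g (u / (1 + u))) \<le> norm (B * norm (euler_weight b c u))"
        by (subst mult.commute) (auto simp: norm_mult abs_mult intro!: mult_right_mono)
    qed
  qed
qed

lemma continuous_on_powr_const:
  fixes f :: "'a::topological_space \<Rightarrow> complex"
  assumes f: "continuous_on A f" and "\<And>x. x \<in> A \<Longrightarrow> f x \<notin> \<real>\<^sub>\<le>\<^sub>0"
  shows "continuous_on A (\<lambda>x. f x powr s)"
proof (rule continuous_on_compose2[OF _ f])
  show "continuous_on (- \<real>\<^sub>\<le>\<^sub>0) (\<lambda>w::complex. w powr s)"
    by (intro holomorphic_on_imp_continuous_on holomorphic_intros) auto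
qed (use assms(2) in auto)

lemma continuous_on_euler_kernel:
  assumes "z \<in> slit_plane"
  shows "continuous_on {0..1} (\<lambda>t. (1 - z * complex_of_real t) powr s)"
  using one_minus_mult_in_slit[OF assms]
  by (intro continuous_on_powr_const continuous_intros) simp

lemma euler_integral_holomorphic:
  assumes bc: "Re b > 0" "Re c > Re b"
  shows "euler_integral a b c holomorphic_on slit_plane"
proof -
  define f where "f z u = euler_weight b c u * (1 - z * of_real (u / (1 + u))) powr (- a)" for z u
  \<comment> \<open>\<open>k'\<close> is the derivative in z of the kernel (1 - z t)^(-a). Its joint
    continuity in z and t gives a bound on compact sets, hence a dominating function near each point
    of the cut plane.\<close>
  define k' where "k' z t = a * of_real t * (1 - z * of_real t) powr (- a - 1)" for z :: complex and t :: real
  have k': "continuous_on (slit_plane \<times> {0..1}) (\<lambda>(z, t). k' z t)"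
    unfolding k'_def case_prod_beta using one_minus_mult_in_slit
    by (intro continuous_on_mult continuous_on_powr_const continuous_intros) auto
  have k'z: "continuous_on {0..1} (k' z)" if "z \<in> slit_plane" for z
    unfolding k'_def using that by (intro continuous_intros continuous_on_euler_kernel)
  have "(\<lambda>z. \<integral>u. f z u \<partial>half_line) holomorphic_on slit_plane"
  proof (rule holomorphic_on_integral[OF open_slit_plane])
    show "integrable half_line (f z)" if "z \<in> slit_plane" for z
      unfolding f_def by (rule integrable_euler_kernel[OF bc continuous_on_euler_kernel[OF that]])
    show "((\<lambda>z. f z u) has_field_derivative euler_weight b c u * k' z (u / (1 + u))) (at z)"
      if "z \<in> slit_plane" "u \<in> space half_line" for z u
    proof -
      define t where "t = u / (1 + u)"
      have "1 - z * of_real t \<notin> \<real>\<^sub>\<le>\<^sub>0"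
        using that ratio_bounds[of u] by (intro one_minus_mult_in_slit) (auto simp: t_def)
      then have "((\<lambda>z. (1 - z * of_real t) powr (- a)) has_field_derivative
          (- a) * (1 - z * of_real t) powr (- a - 1) * (0 - 1 * of_real t)) (at z)"
        by (intro has_field_derivative_powr[THEN DERIV_chain2] DERIV_diff DERIV_const DERIV_cmult_right DERIV_ident)
      then show ?thesis
        unfolding f_def k'_def t_def[symmetric] by (intro DERIV_cmult) (simp add: mult_ac)
    qed
    show "(\<lambda>u. euler_weight b c u * k' z (u / (1 + u))) \<in> borel_measurable half_line"
      if "z \<in> slit_plane" for z
      using integrable_euler_kernel[OF bc k'z[OF that]] by simp
    show "\<exists>r>0. \<exists>w. ball z0 r \<subseteq> slit_plane \<and> integrable half_line w \<and>
       (\<forall>z\<in>ball z0 r. \<forall>u\<in>space half_line. norm (euler_weight b c u * k' z (u / (1 + u))) \<le> w u)"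
      if z0: "z0 \<in> slit_plane" for z0
    proof -
      obtain r where r: "r > 0" "cball z0 r \<subseteq> slit_plane"
        using open_slit_plane z0 open_contains_cball by blast
      have "compact ((\<lambda>(z, t). k' z t) ` (cball z0 r \<times> {0..1}))"
        using r by (intro compact_continuous_image continuous_on_subset[OF k'] compact_Times) auto
      then obtain B where "\<And>y. y \<in> (\<lambda>(z, t). k' z t) ` (cball z0 r \<times> {0..1}) \<Longrightarrow> norm y \<le> B"
        unfolding compact_eq_bounded_closed bounded_iff by meson
      then have B: "norm (k' z t) \<le> B" if "z \<in> cball z0 r" "t \<in> {0..1}" for z t
        using that by (metis (no_types, lifting) SigmaI case_prod_conv imageI)
      have "norm (euler_weight b c u * k' z (u / (1 + u))) \<le> B * norm (euler_weight b c u)"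
        if "z \<in> ball z0 r" "u \<in> space half_line" for z u
      proof -
        have "norm (k' z (u / (1 + u))) \<le> B"
          using that ratio_bounds[of u] by (intro B) auto
        then show ?thesis
          by (subst mult.commute) (simp add: norm_mult mult_right_mono)
      qed
      moreover have "integrable half_line (\<lambda>u. B * norm (euler_weight b c u))"
        using integrable_euler_weight[OF bc] by simp
      ultimately show ?thesis
        using r ball_subset_cball[of z0 r] by blast
    qed
  qed
  then show ?thesis
    by (simp add: f_def euler_integral_def[abs_def])
qed

text \<open>The binomial series of (1 - z t)^(-a) is integrated term by term against the weight, and
  each term is a moment of the weight. As 0 < t < 1, the absolutely convergent binomial series at z,
  times the norm of the weight, justifies the exchange.\<close>

lemma euler_integral_sums:
  assumes bc: "Re b > 0" "Re c > Re b" and z: "norm z < 1"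
  shows "(\<lambda>k. hypergeo_2F1_coeff a b c k * z ^ k) sums
    (Gamma c / (Gamma b * Gamma (c - b)) * euler_integral a b c z)"
proof -
  define T where "T u = u / (1 + u)" for u :: real
  define f where "f k u = ((- a) gchoose k) * (- z) ^ k * (euler_weight b c u * of_real (T u) ^ k)" for k u
  define I where "I k = Gamma (b + of_nat k) * Gamma (c - b) / Gamma (c + of_nat k)" for k
  have int: "has_bochner_integral half_line (f k) (((- a) gchoose k) * (- z) ^ k * I k)" for k
    unfolding f_def T_def I_def
    by (intro has_bochner_integral_mult_right has_bochner_integral_euler_weight bc)
  have f_le: "norm (f k u) \<le> norm (((- a) gchoose k) * z ^ k) * norm (euler_weight b c u)"
    if "u \<in> space half_line" for k u
  proof -
    have "\<bar>T u\<bar> ^ k \<le> 1"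
      using ratio_bounds[of u] that by (intro power_le_one) (auto simp: T_def)
    then have "norm (((- a) gchoose k) * z ^ k) * norm (euler_weight b c u) * \<bar>T u\<bar> ^ k \<le>
        norm (((- a) gchoose k) * z ^ k) * norm (euler_weight b c u) * 1"
      by (intro mult_left_mono) auto
    then show ?thesis
      by (simp add: f_def norm_mult norm_power mult_ac)
  qed
  have summ: "summable (\<lambda>k. norm (((- a) gchoose k) * z ^ k))"
  proof -
    \<comment> \<open>The binomial theorem gives convergence at the larger radius \<open>r\<close>;
      strictly inside it a power series converges absolutely.\<close>
    obtain r where r: "norm z < r" "r < 1" using dense[OF z] by blast
    then have "r > 0" using norm_ge_zero[of z] by linarith
    have "summable (\<lambda>k. ((- a) gchoose k) * of_real r ^ k)"
      using gen_binomial_complex[of "of_real r" "- a"] r \<open>r > 0\<close> by (auto simp: sums_iff)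
    then show ?thesis
      using r \<open>r > 0\<close> by (rule_tac powser_insidea) auto
  qed
  have "(\<lambda>k. \<integral>u. f k u \<partial>half_line) sums (\<integral>u. (\<Sum>k. f k u) \<partial>half_line)"
  proof (rule sums_integral)
    show "integrable half_line (f k)" for k
      using int[of k] by (simp add: has_bochner_integral_iff)
    show "AE u in half_line. summable (\<lambda>k. norm (f k u))"
    proof (rule AE_I2)
      fix u assume "u \<in> space half_line"
      then show "summable (\<lambda>k. norm (f k u))"
        using f_le by (intro summable_comparison_test'[OF summable_mult2[OF summ]]) auto
    qed
    show "summable (\<lambda>k. \<integral>u. norm (f k u) \<partial>half_line)"
    proof (rule summable_comparison_test'[OF summable_mult2[OF summ]])
      fix k :: nat
      have "(\<integral>u. norm (f k u) \<partial>half_line) \<le> (\<integral>u. norm (((- a) gchoose k) * z ^ k) * norm (euler_weight b c u) \<partial>half_line)"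
        using int[of k] integrable_euler_weight[OF bc] f_le
        by (intro integral_mono) (auto simp: has_bochner_integral_iff)
      also have "\<dots> = norm (((- a) gchoose k) * z ^ k) * (\<integral>u. norm (euler_weight b c u) \<partial>half_line)"
        by simp
      finally show "norm (\<integral>u. norm (f k u) \<partial>half_line) \<le>
          norm (((- a) gchoose k) * z ^ k) * (\<integral>u. norm (euler_weight b c u) \<partial>half_line)"
        by simp
    qed
  qed
  also have "(\<lambda>k. \<integral>u. f k u \<partial>half_line) = (\<lambda>k. ((- a) gchoose k) * (- z) ^ k * I k)"
    using int by (auto simp: has_bochner_integral_iff)
  also have "(\<integral>u. (\<Sum>k. f k u) \<partial>half_line) = euler_integral a b c z"
    unfolding euler_integral_def
  proof (rule Bochner_Integration.integral_cong[OF refl])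
    fix u assume u: "u \<in> space half_line"
    have "norm (- (z * of_real (T u))) = norm z * T u"
      using ratio_bounds[of u] u by (simp add: norm_mult T_def del: of_real_divide)
    also have "\<dots> \<le> norm z * 1"
      using ratio_bounds[of u] u by (intro mult_left_mono) (auto simp: T_def)
    finally have "norm (- (z * of_real (T u))) < 1" using z by simp
    from sums_mult[OF gen_binomial_complex[OF this, of "- a"], of "euler_weight b c u"]
    have "(\<lambda>k. f k u) sums (euler_weight b c u * (1 - z * of_real (T u)) powr (- a))"
      unfolding f_def mult_minus_left[symmetric] power_mult_distrib by (simp add: mult_ac)
    then show "(\<Sum>k. f k u) = euler_weight b c u * (1 - z * of_real (u / (1 + u))) powr (- a)"
      by (simp add: sums_iff T_def)
  qed
  finally have *: "(\<lambda>k. ((- a) gchoose k) * (- z) ^ k * I k) sums euler_integral a b c z" .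
  have nz: "b \<notin> \<int>\<^sub>\<le>\<^sub>0" "c \<notin> \<int>\<^sub>\<le>\<^sub>0" "c - b \<notin> \<int>\<^sub>\<le>\<^sub>0"
    using bc by (auto intro!: not_nonpos_Int_if_Re_pos)
  \<comment> \<open>The sign (-1)^k turns the generalized binomial coefficient of -a into (a)_k /
    k!, and the Gamma quotients are Pochhammer symbols.\<close>
  have "Gamma c / (Gamma b * Gamma (c - b)) * (((- a) gchoose k) * (- z) ^ k * I k) =
      hypergeo_2F1_coeff a b c k * z ^ k" for k
  proof -
    have "((- a) gchoose k) * (- z) ^ k = pochhammer a k / fact k * z ^ k"
      unfolding power_minus[of z] gbinomial_pochhammer by (simp flip: power_mult_distrib)
    moreover have "Gamma c / (Gamma b * Gamma (c - b)) * I k = pochhammer b k / pochhammer c k"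
      using nz by (simp add: I_def pochhammer_Gamma Gamma_eq_zero_iff field_simps)
    ultimately have "((- a) gchoose k) * (- z) ^ k * (Gamma c / (Gamma b * Gamma (c - b)) * I k) =
        hypergeo_2F1_coeff a b c k * z ^ k"
      by (simp only: hypergeo_2F1_coeff_def) (simp add: mult_ac)
    then show ?thesis
      by (simp only: mult_ac)
  qed
  with sums_mult[OF *, of "Gamma c / (Gamma b * Gamma (c - b))"] show ?thesis
    by simp
qed

lemma is_hypergeo_2F1_euler_integral:
  assumes "Re b > 0" "Re c > Re b"
  shows "is_hypergeo_2F1 a b c (\<lambda>z. Gamma c / (Gamma b * Gamma (c - b)) * euler_integral a b c z)"
  unfolding is_hypergeo_2F1_def
  using euler_integral_sums[OF assms] euler_integral_holomorphic[OF assms]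
  by (intro conjI ballI holomorphic_on_mult holomorphic_on_const) simp_all

section \<open>The fractional integral\<close>

text \<open>With y = x - w and t = u / (1 + u), the kernel is ((1 - x t) + t w)^(-a). Its integral
  against w^(\<mu>-1) is a scaled Beta integral, equal to a Gamma factor times (1 - x t)^(\<mu>-a)
  t^(-\<mu>). The power t^(-\<mu>) lowers both parameters of the weight by \<mu>, so the result is
  an Euler integral with the same c - b.\<close>

lemma has_bochner_integral_euler_integral_shift:
  assumes re: "Re a > Re \<mu>" "Re \<mu> > 0" "Re b > Re \<mu>" "Re c > Re b" and x: "x < 1"
  shows "has_bochner_integral half_line
    (\<lambda>w. rpow w (\<mu> - 1) * euler_integral a b c (of_real (x - w)))
    (Gamma \<mu> * Gamma (a - \<mu>) / Gamma a * euler_integral (a - \<mu>) (b - \<mu>) (c - \<mu>) (of_real x))"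
proof -
  define T where "T u = u / (1 + u)" for u :: real
  define f where "f a b c \<mu> u w = euler_weight b c u * rpow (1 - (x - w) * T u) (- a) * rpow w (\<mu> - 1)"
    for a b c \<mu> :: complex and u w :: real
  define g where "g a b c \<mu> u = Gamma \<mu> * Gamma (a - \<mu>) / Gamma a *
      (euler_weight (b - \<mu>) (c - \<mu>) u * (1 - of_real x * of_real (T u)) powr (- (a - \<mu>)))"
    for a b c \<mu> :: complex and u :: real
  have T: "0 < T u" "T u < 1" if "u > 0" for u
    using ratio_bounds[OF that] by (auto simp: T_def)
  have xT: "x * T u < 1" if "u > 0" for u
  proof (cases "x \<le> 0")
    case True
    then have "x * T u \<le> 0" using T[OF that] by (simp add: mult_nonpos_nonneg)
    then show ?thesis by simp
  next
    case False
    then have "x * T u \<le> x * 1" using T[OF that] by (intro mult_left_mono) auto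
    then show ?thesis using x by simp
  qed
  have inner: "has_bochner_integral half_line (f a b c \<mu> u) (g a b c \<mu> u)"
    if "Re a > Re \<mu>" "Re \<mu> > 0" "u > 0" for a b c \<mu> u
  proof -
    define A where "A = 1 - x * T u"
    have A: "A > 0" using xT[OF that(3)] by (simp add: A_def)
    have "has_bochner_integral half_line
        (\<lambda>w. euler_weight b c u * (rpow w (\<mu> - 1) * rpow (A + T u * w) (- (\<mu> + (a - \<mu>)))))
        (euler_weight b c u * (rpow A (- (a - \<mu>)) * rpow (T u) (- \<mu>) *
          (Gamma \<mu> * Gamma (a - \<mu>) / Gamma (\<mu> + (a - \<mu>)))))"
      using that A T by (intro has_bochner_integral_mult_right has_bochner_integral_Beta_affine) auto
    moreover have "A + T u * w = 1 - (x - w) * T u" for w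
      by (simp add: A_def algebra_simps)
    moreover have weight: "euler_weight b c u * rpow (T u) (- \<mu>) = euler_weight (b - \<mu>) (c - \<mu>) u"
    proof -
      have "rpow (T u) (- \<mu>) = rpow u (- \<mu>) * rpow (1 + u) \<mu>"
        using that by (simp add: T_def rpow_divide)
      then show ?thesis
        using rpow_add[of u "b - 1" "- \<mu>"] rpow_add[of "1 + u" "- c" \<mu>]
        by (simp add: euler_weight_def algebra_simps)
    qed
    moreover have "rpow A (- (a - \<mu>)) = (1 - of_real x * of_real (T u)) powr (- (a - \<mu>))"
      using A by (simp add: rpow_eq_powr A_def)
    then have "euler_weight b c u * (rpow A (- (a - \<mu>)) * rpow (T u) (- \<mu>) *
        (Gamma \<mu> * Gamma (a - \<mu>) / Gamma (\<mu> + (a - \<mu>)))) = g a b c \<mu> u"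
      unfolding g_def weight[symmetric] by (simp add: mult_ac)
    ultimately show ?thesis
      unfolding f_def by (simp add: mult.assoc mult.commute[of "rpow _ (\<mu> - 1)"])
  qed
  have int_g: "has_bochner_integral half_line (g a b c \<mu>)
      (Gamma \<mu> * Gamma (a - \<mu>) / Gamma a * euler_integral (a - \<mu>) (b - \<mu>) (c - \<mu>) (of_real x))"
    if "Re b > Re \<mu>" "Re c > Re b" for a b c \<mu>
    unfolding g_def euler_integral_def T_def has_bochner_integral_iff
    using integrable_euler_kernel[OF _ _ continuous_on_euler_kernel[OF of_real_in_slit_plane[OF x]],
        of "b - \<mu>" "c - \<mu>" "- (a - \<mu>)"] that
    by simp
  show ?thesis
  proof (rule half_line_pair.has_bochner_integral_Fubini)
    show "case_prod (f a b c \<mu>) \<in> borel_measurable (half_line \<Otimes>\<^sub>M half_line)"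
      unfolding f_def T_def euler_weight_def by measurable
    show "has_bochner_integral half_line (f a b c \<mu> u) (g a b c \<mu> u)" if "u \<in> space half_line" for u
      using inner that re by simp
    show "has_bochner_integral half_line (g a b c \<mu>)
      (Gamma \<mu> * Gamma (a - \<mu>) / Gamma a * euler_integral (a - \<mu>) (b - \<mu>) (c - \<mu>) (of_real x))"
      using int_g re by simp
    \<comment> \<open>The norm of the integrand is the same integrand at the real parts of the
      parameters, so \<open>inner\<close> and \<open>int_g\<close> yield absolute integrability as
      well.\<close>
    let ?r = "\<lambda>z. complex_of_real (Re z)"
    have "of_real (norm (f a b c \<mu> u w)) = f (?r a) (?r b) (?r c) (?r \<mu>) u w" for u w
      by (simp add: f_def euler_weight_def norm_mult of_real_norm_rpow)
    then have "has_bochner_integral half_line (\<lambda>w. norm (f a b c \<mu> u w)) (Re (g (?r a) (?r b) (?r c) (?r \<mu>) u))"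
      if "u > 0" for u
      using inner that re by (intro has_bochner_integral_norm_eq_Re) auto
    moreover have "integrable half_line (\<lambda>u. Re (g (?r a) (?r b) (?r c) (?r \<mu>) u))"
      using int_g[of "?r \<mu>" "?r b" "?r c" "?r a"] re by (auto simp: has_bochner_integral_iff)
    ultimately show "integrable half_line (\<lambda>u. \<integral>w. norm (f a b c \<mu> u w) \<partial>half_line)"
      by (subst Bochner_Integration.integrable_cong[OF refl]) (auto simp: has_bochner_integral_iff)
    show "(\<integral>u. f a b c \<mu> u w \<partial>half_line) = rpow w (\<mu> - 1) * euler_integral a b c (of_real (x - w))"
      if "w \<in> space half_line" for w
    proof -
      have "f a b c \<mu> u w = rpow w (\<mu> - 1) *
          (euler_weight b c u * (1 - of_real (x - w) * of_real (u / (1 + u))) powr (- a))"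
        if "u > 0" for u
      proof -
        have "0 < 1 - (x - w) * T u"
          using xT[OF that] mult_pos_pos[OF _ T(1)[OF that], of w] \<open>w \<in> space half_line\<close>
          by (simp add: left_diff_distrib)
        then have "rpow (1 - (x - w) * T u) (- a) = (1 - of_real (x - w) * of_real (u / (1 + u))) powr (- a)"
          by (simp add: rpow_eq_powr T_def)
        then show ?thesis
          by (simp add: f_def)
      qed
      then have "(\<integral>u. f a b c \<mu> u w \<partial>half_line) = (\<integral>u. rpow w (\<mu> - 1) *
          (euler_weight b c u * (1 - of_real (x - w) * of_real (u / (1 + u))) powr (- a)) \<partial>half_line)"
        by (intro Bochner_Integration.integral_cong) auto
      then show ?thesis
        unfolding euler_integral_def by (simp only: integral_mult_right_zero)
    qed
  qed
qed

section \<open>The contiguous relation and the passage to all admissible \<open>c\<close>\<close>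

lemma not_nonpos_Int_plus_one: "c \<notin> \<int>\<^sub>\<le>\<^sub>0 \<Longrightarrow> c + 1 \<notin> (\<int>\<^sub>\<le>\<^sub>0 :: complex set)"
  using plus_one_in_nonpos_Ints_imp by blast

lemma not_nonpos_Int_nonzero: "c \<notin> \<int>\<^sub>\<le>\<^sub>0 \<Longrightarrow> c \<noteq> (0 :: complex)"
  by auto

text \<open>
  With \<open>\<theta> = z d/dz\<close> this is the coefficient form of \<open>(\<theta> + c) F(a,b;c+1) = c F(a,b;c)\<close>, where the
  derivative has been replaced by \<open>F'(a,b;c+1) = ab/(c+1) F(a+1,b+1;c+2)\<close>.
\<close>

lemma hypergeo_2F1_coeff_Suc:
  assumes c: "c \<notin> \<int>\<^sub>\<le>\<^sub>0"
  shows "hypergeo_2F1_coeff a b c (Suc j) = hypergeo_2F1_coeff a b (c + 1) (Suc j) +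
    a * b / (c * (c + 1)) * hypergeo_2F1_coeff (a + 1) (b + 1) (c + 2) j"
proof -
  define P where "P = pochhammer (c + 1) j"
  have P: "P \<noteq> 0"
    using not_nonpos_Int_plus_one[OF c] by (auto simp: P_def pochhammer_eq_0_iff)
  have nz: "c \<noteq> 0" "c + 1 \<noteq> 0"
    using not_nonpos_Int_nonzero[OF c] not_nonpos_Int_nonzero[OF not_nonpos_Int_plus_one[OF c]] by auto
  define d where "d = c + 1 + of_nat j"
  have d: "d \<noteq> 0"
    using c plus_of_nat_eq_0_imp[of c "Suc j"] by (auto simp: d_def add_ac)
  have c2: "pochhammer (c + 2) j = d * P / (c + 1)"
    using pochhammer_rec[of "c + 1" j] pochhammer_rec'[of "c + 1" j] nz
    by (simp add: P_def d_def field_simps)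
  have c1: "pochhammer (c + 1) (Suc j) = d * P"
    using pochhammer_rec'[of "c + 1" j] by (simp add: P_def d_def)
  have c0: "pochhammer c (Suc j) = c * P"
    by (simp add: P_def pochhammer_rec)
  \<comment> \<open>After the common factor \<open>X\<close> below is removed, the claim is this
    partial fraction identity; it holds because \<open>d - c\<close> is j + 1.\<close>
  have "1 / (c * of_nat (Suc j)) = 1 / (d * of_nat (Suc j)) + 1 / (c * d)"
    using nz d by (simp add: field_simps del: of_nat_Suc) (simp add: d_def algebra_simps)
  moreover define X where "X = a * pochhammer (a + 1) j * (b * pochhammer (b + 1) j) / (P * fact j)"
  ultimately have "X * (1 / (c * of_nat (Suc j))) = X * (1 / (d * of_nat (Suc j))) + X * (1 / (c * d))"
    by (simp only: distrib_left)
  moreover have "hypergeo_2F1_coeff a b c (Suc j) = X * (1 / (c * of_nat (Suc j)))"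
    unfolding hypergeo_2F1_coeff_def X_def c0 pochhammer_rec[of a] pochhammer_rec[of b] fact_Suc
    by (simp add: mult_ac del: of_nat_Suc)
  moreover have "hypergeo_2F1_coeff a b (c + 1) (Suc j) = X * (1 / (d * of_nat (Suc j)))"
    unfolding hypergeo_2F1_coeff_def X_def c1 pochhammer_rec[of a] pochhammer_rec[of b] fact_Suc
    by (simp add: mult_ac del: of_nat_Suc)
  moreover have "a * b / (c * (c + 1)) * hypergeo_2F1_coeff (a + 1) (b + 1) (c + 2) j = X * (1 / (c * d))"
    unfolding hypergeo_2F1_coeff_def X_def c2 using nz by (simp add: mult_ac)
  ultimately show ?thesis
    by simp
qed

text \<open>Multiplication by z moves the series of \<open>g\<close> up by one index, so that the
  coefficient recurrence applies from index 1 on. At index 0 the series for \<open>c\<close> and for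
  \<open>c + 1\<close> both have the coefficient 1.\<close>

lemma is_hypergeo_2F1_contiguous:
  assumes c: "c \<notin> \<int>\<^sub>\<le>\<^sub>0"
    and f: "is_hypergeo_2F1 a b (c + 1) f" and g: "is_hypergeo_2F1 (a + 1) (b + 1) (c + 2) g"
  shows "is_hypergeo_2F1 a b c (\<lambda>z. f z + a * b / (c * (c + 1)) * (z * g z))"
  unfolding is_hypergeo_2F1_def
proof (intro conjI ballI)
  show "(\<lambda>z. f z + a * b / (c * (c + 1)) * (z * g z)) holomorphic_on slit_plane"
    using f g unfolding is_hypergeo_2F1_def
    by (intro holomorphic_on_add holomorphic_on_mult holomorphic_on_const holomorphic_on_ident) auto
next
  fix z :: complex assume z: "z \<in> ball 0 1"
  let ?C = "a * b / (c * (c + 1))"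
  have f1: "(\<lambda>k. hypergeo_2F1_coeff a b (c + 1) k * z ^ k) sums (f z - 1 + 1)"
    using f z by (simp add: is_hypergeo_2F1_def)
  have coeff_0: "hypergeo_2F1_coeff a b c 0 = 1" for a b c
    by (simp add: hypergeo_2F1_coeff_def)
  have "(\<lambda>k. hypergeo_2F1_coeff a b (c + 1) (Suc k) * z ^ Suc k) sums (f z - 1)"
    using f1 by (subst sums_Suc_iff) (simp add: coeff_0)
  moreover have "(\<lambda>k. ?C * z * (hypergeo_2F1_coeff (a + 1) (b + 1) (c + 2) k * z ^ k)) sums (?C * z * g z)"
    using g z by (intro sums_mult) (simp add: is_hypergeo_2F1_def)
  ultimately have "(\<lambda>k. hypergeo_2F1_coeff a b (c + 1) (Suc k) * z ^ Suc k +
      ?C * z * (hypergeo_2F1_coeff (a + 1) (b + 1) (c + 2) k * z ^ k)) sums (f z - 1 + ?C * z * g z)"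
    by (rule sums_add)
  also have "(\<lambda>k. hypergeo_2F1_coeff a b (c + 1) (Suc k) * z ^ Suc k +
      ?C * z * (hypergeo_2F1_coeff (a + 1) (b + 1) (c + 2) k * z ^ k)) =
      (\<lambda>k. hypergeo_2F1_coeff a b c (Suc k) * z ^ Suc k)"
    unfolding hypergeo_2F1_coeff_Suc[OF c] by (simp add: fun_eq_iff distrib_right)
  finally show "(\<lambda>k. hypergeo_2F1_coeff a b c k * z ^ k) sums (f z + ?C * (z * g z))"
    by (subst (asm) sums_Suc_iff) (simp add: coeff_0 mult.assoc)
qed

text \<open>Euler's integral covers Re c > Re b > 0. Each use of the contiguous relation passes to
  parameters where Re (c - b) is larger by one, while Re b does not decrease, so finitely many steps
  suffice.\<close>

lemma is_hypergeo_2F1_exists: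
  assumes "c \<notin> \<int>\<^sub>\<le>\<^sub>0" "Re b > 0"
  shows "is_hypergeo_2F1 a b c (hypergeo_2F1 a b c)"
proof -
  have "\<exists>f. is_hypergeo_2F1 a b c f" if "c \<notin> \<int>\<^sub>\<le>\<^sub>0" "Re b > 0" "Re c + real n > Re b" for n
    using that
  proof (induction n arbitrary: a b c)
    case 0
    then show ?case using is_hypergeo_2F1_euler_integral[of b c a] by auto
  next
    case (Suc n)
    have c: "c + 1 \<notin> \<int>\<^sub>\<le>\<^sub>0" "c + 2 \<notin> \<int>\<^sub>\<le>\<^sub>0"
      using not_nonpos_Int_plus_one[OF Suc.prems(1)]
        not_nonpos_Int_plus_one[of "c + 1"] by (auto simp: add.assoc)
    obtain f where "is_hypergeo_2F1 a b (c + 1) f"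
      using Suc.IH[of "c + 1" b a] Suc.prems c by auto
    moreover obtain g where "is_hypergeo_2F1 (a + 1) (b + 1) (c + 2) g"
      using Suc.IH[of "c + 2" "b + 1" "a + 1"] Suc.prems c by auto
    ultimately show ?case
      using is_hypergeo_2F1_contiguous[OF Suc.prems(1)] by blast
  qed
  moreover obtain n :: nat where "Re b - Re c < real n"
    using reals_Archimedean2 by blast
  then have "Re c + real n > Re b" by simp
  ultimately show ?thesis
    using assms is_hypergeo_2F1_hypergeo_2F1 by blast
qed

lemma hypergeo_2F1_contiguous:
  assumes "c \<notin> \<int>\<^sub>\<le>\<^sub>0" "Re b > 0" "z \<in> slit_plane"
  shows "hypergeo_2F1 a b c z = hypergeo_2F1 a b (c + 1) z +
    a * b / (c * (c + 1)) * (z * hypergeo_2F1 (a + 1) (b + 1) (c + 2) z)"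
proof -
  have "c + 1 \<notin> \<int>\<^sub>\<le>\<^sub>0" "c + 2 \<notin> \<int>\<^sub>\<le>\<^sub>0"
    using not_nonpos_Int_plus_one[OF assms(1)] not_nonpos_Int_plus_one[of "c + 1"] by (auto simp: add.assoc)
  then show ?thesis
    using assms by (intro hypergeo_2F1_eqI is_hypergeo_2F1_contiguous is_hypergeo_2F1_exists) auto
qed

text \<open>The claimed value of the Weyl fractional integral of order \<mu>, named because the
  induction needs it at several parameter tuples.\<close>

definition weyl_rhs :: "complex \<Rightarrow> complex \<Rightarrow> complex \<Rightarrow> complex \<Rightarrow> complex \<Rightarrow> complex" where
  "weyl_rhs a b c \<mu> z = Gamma (a - \<mu>) / Gamma a * (Gamma (b - \<mu>) / Gamma b) * (Gamma c / Gamma (c - \<mu>))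
     * hypergeo_2F1 (a - \<mu>) (b - \<mu>) (c - \<mu>) z"

text \<open>This is the relation that the integral inherits from the contiguous relation when its
  factor y = x - w is split, the term in w having order \<mu> + 1. It amounts to the contiguous
  relation at (a - \<mu>, b - \<mu>, c - \<mu>) with the Gamma factors matched.\<close>

lemma weyl_rhs_contiguous:
  assumes c: "c \<notin> \<int>\<^sub>\<le>\<^sub>0" "c - \<mu> \<notin> \<int>\<^sub>\<le>\<^sub>0"
    and re: "Re a > Re \<mu>" "Re \<mu> > 0" "Re b > Re \<mu>" and z: "z \<in> slit_plane"
  shows "weyl_rhs a b c \<mu> z = weyl_rhs a b (c + 1) \<mu> z + a * b / (c * (c + 1)) *
    (z * weyl_rhs (a + 1) (b + 1) (c + 2) \<mu> z - \<mu> * weyl_rhs (a + 1) (b + 1) (c + 2) (\<mu> + 1) z)"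
proof -
  \<comment> \<open>Only these two functions occur on the right: the term of order \<mu> + 1 also
    leads to \<open>\<phi>\<close>, because c + 2 - (\<mu> + 1) = c - \<mu> + 1.\<close>
  define \<phi> where "\<phi> = hypergeo_2F1 (a - \<mu>) (b - \<mu>) (c - \<mu> + 1) z"
  define \<psi> where "\<psi> = hypergeo_2F1 (a - \<mu> + 1) (b - \<mu> + 1) (c - \<mu> + 2) z"
  define K where "K = Gamma (a - \<mu>) / Gamma a * (Gamma (b - \<mu>) / Gamma b) * (Gamma c / Gamma (c - \<mu>))"
  have nonint: "a \<notin> \<int>\<^sub>\<le>\<^sub>0" "b \<notin> \<int>\<^sub>\<le>\<^sub>0" "a - \<mu> \<notin> \<int>\<^sub>\<le>\<^sub>0" "b - \<mu> \<notin> \<int>\<^sub>\<le>\<^sub>0"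
    using re by (auto intro!: not_nonpos_Int_if_Re_pos)
  have c1: "c + 1 \<notin> \<int>\<^sub>\<le>\<^sub>0" "c - \<mu> + 1 \<notin> \<int>\<^sub>\<le>\<^sub>0"
    using c by (auto intro!: not_nonpos_Int_plus_one)
  have nz: "a \<noteq> 0" "b \<noteq> 0" "c \<noteq> 0" "c + 1 \<noteq> 0" "c - \<mu> \<noteq> 0" "c - \<mu> + 1 \<noteq> 0"
    "Gamma a \<noteq> 0" "Gamma b \<noteq> 0" "Gamma (c - \<mu>) \<noteq> 0"
    using nonint c c1 not_nonpos_Int_nonzero by (auto simp: Gamma_eq_zero_iff)
  have "Gamma (c + 1 + 1) = (c + 1) * Gamma (c + 1)" "Gamma (c - \<mu> + 1 + 1) = (c - \<mu> + 1) * Gamma (c - \<mu> + 1)"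
    by (rule Gamma_plus1[OF c1(1)] Gamma_plus1[OF c1(2)])+
  then have G: "Gamma (a + 1) = a * Gamma a" "Gamma (b + 1) = b * Gamma b"
    "Gamma (a - \<mu> + 1) = (a - \<mu>) * Gamma (a - \<mu>)" "Gamma (b - \<mu> + 1) = (b - \<mu>) * Gamma (b - \<mu>)"
    "Gamma (c + 1) = c * Gamma c" "Gamma (c - \<mu> + 1) = (c - \<mu>) * Gamma (c - \<mu>)"
    "Gamma (c + 2) = (c + 1) * (c * Gamma c)"
    "Gamma (c - \<mu> + 2) = (c - \<mu> + 1) * ((c - \<mu>) * Gamma (c - \<mu>))"
    using nonint c by (simp_all add: Gamma_plus1 add.assoc)
  have shift: "a + 1 - \<mu> = a - \<mu> + 1" "b + 1 - \<mu> = b - \<mu> + 1" "c + 1 - \<mu> = c - \<mu> + 1"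
    "c + 2 - \<mu> = c - \<mu> + 2" "a + 1 - (\<mu> + 1) = a - \<mu>" "b + 1 - (\<mu> + 1) = b - \<mu>"
    "c + 2 - (\<mu> + 1) = c - \<mu> + 1"
    by simp_all
  have "weyl_rhs a b c \<mu> z =
      K * (\<phi> + (a - \<mu>) * (b - \<mu>) / ((c - \<mu>) * (c - \<mu> + 1)) * (z * \<psi>))"
    unfolding weyl_rhs_def K_def \<phi>_def \<psi>_def using c re z by (subst hypergeo_2F1_contiguous) auto
  moreover have "weyl_rhs a b (c + 1) \<mu> z = K * (c / (c - \<mu>)) * \<phi>"
    unfolding weyl_rhs_def K_def shift \<phi>_def[symmetric] G by (simp add: mult_ac)
  moreover have "weyl_rhs (a + 1) (b + 1) (c + 2) \<mu> z =
      K * ((a - \<mu>) * (b - \<mu>) / (a * b) * (c * (c + 1)) / ((c - \<mu>) * (c - \<mu> + 1))) * \<psi>"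
    unfolding weyl_rhs_def K_def shift \<psi>_def[symmetric] G by (simp add: mult_ac)
  moreover have "weyl_rhs (a + 1) (b + 1) (c + 2) (\<mu> + 1) z =
      K * (c * (c + 1) / (a * b * (c - \<mu>))) * \<phi>"
    unfolding weyl_rhs_def K_def shift \<phi>_def[symmetric] G by (simp add: mult_ac)
  moreover
  {
    define C where "C = a * b / (c * (c + 1))"
    define q r s where "q = c / (c - \<mu>)" and "r = c * (c + 1) / (a * b * (c - \<mu>))"
      and "s = (a - \<mu>) * (b - \<mu>) / (a * b) * (c * (c + 1)) / ((c - \<mu>) * (c - \<mu> + 1))"
    have r: "C * r = 1 / (c - \<mu>)"
      using nz(1-4) by (simp add: C_def r_def)
    have s: "C * s = (a - \<mu>) * (b - \<mu>) / ((c - \<mu>) * (c - \<mu> + 1))"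
      using nz(1-4) by (simp add: C_def s_def)
    \<comment> \<open>The two contributions to the coefficient of \<open>\<phi>\<close> are c / (c -
      \<mu>) and - \<mu> / (c - \<mu>).\<close>
    have "q - \<mu> * (C * r) = 1"
      unfolding q_def r using nz(5) by (simp flip: diff_divide_distrib)
    moreover have "K * q * \<phi> + C * (z * (K * s * \<psi>) - \<mu> * (K * r * \<phi>)) =
        K * ((q - \<mu> * (C * r)) * \<phi> + C * s * (z * \<psi>))"
      by (simp only: ring_distribs mult_ac) simp
    ultimately have "K * (\<phi> + C * s * (z * \<psi>)) = K * q * \<phi> + C * (z * (K * s * \<psi>) - \<mu> * (K * r * \<phi>))"
      by simp
    note this[unfolded s, unfolded C_def q_def r_def s_def]
  }
  ultimately show ?thesis
    by (simp only:)
qed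

text \<open>The variable is w = x - y. The induction is on an \<open>n\<close> with Re c + n > Re b:
  Euler's integral is the base, and in the step the value is assembled by linearity from three
  integrals supplied by the induction hypothesis. One of them has order \<mu> + 1, so \<mu> is
  generalized.\<close>

lemma has_bochner_integral_hypergeo_2F1:
  assumes "c \<notin> \<int>\<^sub>\<le>\<^sub>0" "c - \<mu> \<notin> \<int>\<^sub>\<le>\<^sub>0" "Re a > Re \<mu>" "Re \<mu> > 0" "Re b > Re \<mu>" and x: "x < 1"
  shows "has_bochner_integral half_line
    (\<lambda>w. hypergeo_2F1 a b c (of_real (x - w)) * (rpow w (\<mu> - 1) / Gamma \<mu>))
    (weyl_rhs a b c \<mu> (of_real x))"
proof -
  obtain n :: nat where "Re b - Re c < real n"
    using reals_Archimedean2 by blast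
  then have "Re c + real n > Re b" by simp
  with assms show ?thesis
  proof (induction n arbitrary: a b c \<mu>)
    case 0
    define C where "C = Gamma c / (Gamma b * Gamma (c - b))"
    have nz: "Gamma \<mu> \<noteq> 0" "Gamma (b - \<mu>) \<noteq> 0" "Gamma (c - b) \<noteq> 0"
      using 0 by (auto simp: Gamma_eq_zero_iff intro!: not_nonpos_Int_if_Re_pos)
    have "has_bochner_integral half_line
        (\<lambda>w. C / Gamma \<mu> * (rpow w (\<mu> - 1) * euler_integral a b c (of_real (x - w))))
        (C / Gamma \<mu> * (Gamma \<mu> * Gamma (a - \<mu>) / Gamma a *
          euler_integral (a - \<mu>) (b - \<mu>) (c - \<mu>) (of_real x)))"
      using 0 by (intro has_bochner_integral_mult_right has_bochner_integral_euler_integral_shift) auto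
    moreover have "C / Gamma \<mu> * (rpow w (\<mu> - 1) * euler_integral a b c (of_real (x - w))) =
        hypergeo_2F1 a b c (of_real (x - w)) * (rpow w (\<mu> - 1) / Gamma \<mu>)"
      if "w \<in> space half_line" for w
    proof -
      have "hypergeo_2F1 a b c (of_real (x - w)) = C * euler_integral a b c (of_real (x - w))"
        unfolding C_def using 0 that
        by (intro hypergeo_2F1_eqI is_hypergeo_2F1_euler_integral of_real_in_slit_plane) auto
      then show ?thesis by simp
    qed
    moreover have "C / Gamma \<mu> * (Gamma \<mu> * Gamma (a - \<mu>) / Gamma a *
          euler_integral (a - \<mu>) (b - \<mu>) (c - \<mu>) (of_real x)) = weyl_rhs a b c \<mu> (of_real x)"
    proof -
      have "hypergeo_2F1 (a - \<mu>) (b - \<mu>) (c - \<mu>) (of_real x) =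
          Gamma (c - \<mu>) / (Gamma (b - \<mu>) * Gamma (c - \<mu> - (b - \<mu>))) *
          euler_integral (a - \<mu>) (b - \<mu>) (c - \<mu>) (of_real x)"
        using 0 by (intro hypergeo_2F1_eqI is_hypergeo_2F1_euler_integral of_real_in_slit_plane) auto
      moreover have "Gamma (c - \<mu>) \<noteq> 0"
        using 0 by (simp add: Gamma_eq_zero_iff)
      ultimately show ?thesis
        using nz by (simp add: weyl_rhs_def C_def mult_ac)
    qed
    ultimately show ?case
      by (subst has_bochner_integral_cong[OF refl _ refl, symmetric]) auto
  next
    case (Suc n)
    txt \<open>The factor \<open>y = x - w\<close> of the contiguous relation splits into \<open>x\<close> and \<open>- w\<close>; the extra \<open>w\<close>
      raises the order of the fractional integral from \<open>\<mu>\<close> to \<open>\<mu> + 1\<close>.\<close>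
    let ?F = "\<lambda>w. hypergeo_2F1 a b (c + 1) (of_real (x - w))"
    let ?G = "\<lambda>w. hypergeo_2F1 (a + 1) (b + 1) (c + 2) (of_real (x - w))"
    let ?C = "a * b / (c * (c + 1))"
    have c: "c + 1 \<notin> \<int>\<^sub>\<le>\<^sub>0" "c + 2 \<notin> \<int>\<^sub>\<le>\<^sub>0" "c + 1 - \<mu> \<notin> \<int>\<^sub>\<le>\<^sub>0" "c + 2 - \<mu> \<notin> \<int>\<^sub>\<le>\<^sub>0"
      "c + 2 - (\<mu> + 1) \<notin> \<int>\<^sub>\<le>\<^sub>0"
      using not_nonpos_Int_plus_one[OF Suc.prems(1)] not_nonpos_Int_plus_one[OF Suc.prems(2)]
        not_nonpos_Int_plus_one[of "c + 1"] not_nonpos_Int_plus_one[of "c - \<mu> + 1"]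
      by (auto simp: algebra_simps)
    have "has_bochner_integral half_line
        (\<lambda>w. ?F w * (rpow w (\<mu> - 1) / Gamma \<mu>) + ?C *
          (of_real x * (?G w * (rpow w (\<mu> - 1) / Gamma \<mu>)) -
           \<mu> * (?G w * (rpow w (\<mu> + 1 - 1) / Gamma (\<mu> + 1)))))
        (weyl_rhs a b (c + 1) \<mu> (of_real x) + ?C *
          (of_real x * weyl_rhs (a + 1) (b + 1) (c + 2) \<mu> (of_real x) -
           \<mu> * weyl_rhs (a + 1) (b + 1) (c + 2) (\<mu> + 1) (of_real x)))"
      using Suc.prems c
      by (intro has_bochner_integral_add has_bochner_integral_diff has_bochner_integral_mult_right Suc.IH) auto
    moreover have "?F w * (rpow w (\<mu> - 1) / Gamma \<mu>) + ?C *
          (of_real x * (?G w * (rpow w (\<mu> - 1) / Gamma \<mu>)) -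
           \<mu> * (?G w * (rpow w (\<mu> + 1 - 1) / Gamma (\<mu> + 1)))) =
        hypergeo_2F1 a b c (of_real (x - w)) * (rpow w (\<mu> - 1) / Gamma \<mu>)"
      if "w \<in> space half_line" for w
    proof -
      have "\<mu> \<notin> \<int>\<^sub>\<le>\<^sub>0" using Suc.prems by (intro not_nonpos_Int_if_Re_pos) auto
      \<comment> \<open>The factor \<mu> in front of the term of order \<mu> + 1 compensates the
        change of normalization from Gamma(\<mu>) to Gamma(\<mu> + 1).\<close>
      then have "Gamma (\<mu> + 1) = \<mu> * Gamma \<mu>" "\<mu> \<noteq> 0"
        by (auto simp: Gamma_plus1)
      moreover have "rpow w (\<mu> + 1 - 1) = of_real w * rpow w (\<mu> - 1)"
        using that rpow_add[of w 1 "\<mu> - 1"] by (simp add: rpow_one)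
      ultimately have "\<mu> * (?G w * (rpow w (\<mu> + 1 - 1) / Gamma (\<mu> + 1))) =
          of_real w * ?G w * (rpow w (\<mu> - 1) / Gamma \<mu>)"
        by simp
      moreover have "hypergeo_2F1 a b c (of_real (x - w)) = ?F w + ?C * (of_real (x - w) * ?G w)"
        using Suc.prems that by (intro hypergeo_2F1_contiguous of_real_in_slit_plane) auto
      ultimately show ?thesis
        by (simp only: of_real_diff ring_distribs mult_ac)
    qed
    moreover have "weyl_rhs a b c \<mu> (of_real x) = weyl_rhs a b (c + 1) \<mu> (of_real x) + ?C *
          (of_real x * weyl_rhs (a + 1) (b + 1) (c + 2) \<mu> (of_real x) -
           \<mu> * weyl_rhs (a + 1) (b + 1) (c + 2) (\<mu> + 1) (of_real x))"
      using Suc.prems by (intro weyl_rhs_contiguous of_real_in_slit_plane) auto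
    ultimately show ?case
      by (subst has_bochner_integral_cong[OF refl _ refl, symmetric]) auto
  qed
qed

text \<open>The Lebesgue integral of a non-integrable function is 0 by default, so integrability is
  asserted together with the value. The reflection y = x - w carries the half-line w > 0 to y <
  x.\<close>

theorem proposition4p1:
  fixes a b c \<mu> :: complex and x :: real
  assumes "c \<notin> \<int>\<^sub>\<le>\<^sub>0" and "c - \<mu> \<notin> \<int>\<^sub>\<le>\<^sub>0"
    and "Re a > Re \<mu>" and "Re \<mu> > 0" and "Re b > Re \<mu>"
    and "x < 1"
  shows "set_integrable lborel {..<x}
           (\<lambda>y. hypergeo_2F1 a b c (of_real y) * (of_real (x - y) powr (\<mu> - 1) / Gamma \<mu>))
       \<and> (LBINT y:{..<x}.
           hypergeo_2F1 a b c (of_real y) * (of_real (x - y) powr (\<mu> - 1) / Gamma \<mu>))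
         = Gamma (a - \<mu>) / Gamma a * (Gamma (b - \<mu>) / Gamma b) * (Gamma c / Gamma (c - \<mu>))
           * hypergeo_2F1 (a - \<mu>) (b - \<mu>) (c - \<mu>) (of_real x)"
proof -
  let ?f = "\<lambda>y. hypergeo_2F1 a b c (of_real y) * (of_real (x - y) powr (\<mu> - 1) / Gamma \<mu>)"
  let ?R = "weyl_rhs a b c \<mu> (of_real x)"
  have "has_bochner_integral lborel
      (\<lambda>w. indicator {0<..} w *\<^sub>R (hypergeo_2F1 a b c (of_real (x - w)) * (rpow w (\<mu> - 1) / Gamma \<mu>))) ?R"
    using has_bochner_integral_hypergeo_2F1[OF assms] by (simp only: has_bochner_integral_half_line_iff)
  also have "(\<lambda>w. indicator {0<..} w *\<^sub>R (hypergeo_2F1 a b c (of_real (x - w)) * (rpow w (\<mu> - 1) / Gamma \<mu>))) =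
      (\<lambda>w. indicator {..<x} (x + (- 1) * w) *\<^sub>R ?f (x + (- 1) * w))"
    by (auto simp: fun_eq_iff indicator_def rpow_eq_powr)
  finally have "has_bochner_integral lborel (\<lambda>y. indicator {..<x} y *\<^sub>R ?f y) ?R"
    using lborel_has_bochner_integral_real_affine_iff[of "- 1" "\<lambda>y. indicator {..<x} y *\<^sub>R ?f y" ?R x]
    by simp
  then show ?thesis
    by (simp only: set_integrable_def set_lebesgue_integral_def has_bochner_integral_iff weyl_rhs_def)
qed

end
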